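(* Let $(p_n)_{n}$ be a sequence in $(0,1)$ and define $$\alpha_1 = \limsup_n \frac{\log(1/p_n)}{\log n},\qquad \alpha_2 = \limsup_n \frac{\log\left(1/(1-p_n)\right)}{\log n}.$$ Suppose $\mathbf{p} \in \mathcal{N}(a,n,p_n)$ for some constant $0 \le a < 1$; that is, there is a constant $N = N(a)\ge 1$, not depending on $n$, such that for all $n \ge N$ $$\inf_{1\le i\le n}\ \inf_{S}\ \frac{1}{\#S}\sum_{j\in S} p(i,j) \ \ge\ p_n ,$$ where, for fixed $i$, the inner infimum is over all sets $S\subset\{1,\dots,n\}$ with $\#S \ge n^{a}$ and $i\notin S$. (i) Suppose $0<\alpha_1<2$ and let $\eta,\gamma>0$ be such that $\max\left(\frac{\alpha_1}{2},a\right)+\gamma<\eta<1$. Then $\alpha_2=0$, and there is a positive integer $N_1=N_1(\eta,\gamma,\alpha_1,a)\ge 1$ so that $$\mathbb{P}_{\mathbf{p}}\left(\omega(G(n,\mathbf{p}))\ge (1-\eta)\frac{\log n}{\log(1/p_n)}\right)\ge 1-3\exp\left(-n^{2\eta-2\gamma-\alpha_1}\right)$$ for all $n\ge N_1$. (ii) Suppose $\alpha_1=\alpha_2=0$ and let $\eta,\gamma>0$ be such that $a<\gamma<\eta<1$. Then there is a positive integer $N_2=N_2(\eta,\gamma)\ge 1$ so that $$\mathbb{P}_{\mathbf{p}}\left(\omega(G(n,\mathbf{p}))\ge (1-\eta)\frac{\log n}{\log(1/p_n)}\right)\ge 1-3\exp\left(-n^{2\eta-2\gamma}\right)$$ for all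 $n\ge N_2$. (iii) Suppose $0<\alpha_2<1$ and let $\eta,\gamma>0$ be such that $\max\left(\gamma-\frac{\alpha_2}{2},a\right)<\eta<1-\alpha_2$. Then $\alpha_1=0$, and there is a positive integer $N_3=N_3(\eta,\gamma)\ge 1$ so that $$\mathbb{P}_{\mathbf{p}}\left(\omega(G(n,\mathbf{p}))\ge (1-\alpha_2-\eta)\frac{\log n}{\log(1/p_n)}\right)\ge 1-3\exp\left(-n^{2\eta-2\gamma+\alpha_2}\right)$$ for all $n\ge N_3$.
   Context: For each $n$, $\mathbf{p}=\{p(i,j)\}_{1\le i\ne j\le n}$ is a symmetric vector of probabilities in $[0,1]$ (allowed to depend on $n$). $G(n,\mathbf{p})$ is the inhomogeneous Erdős–Rényi random graph on vertex set $\{1,\dots,n\}$: each edge $\{i,j\}$ is present ("open") with probability $p(i,j)$, independently over unordered pairs; $\mathbb{P}_{\mathbf{p}}$ is the corresponding probability measure. $\omega(G)$ denotes the number of vertices in a largest clique (complete induced subgraph) of $G$. $\#S$ is the cardinality of $S$. All constants are independent of $n$; the sequence $(p_n)$ and the constant $N(a)$ are regarded as fixed.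
   Formalization: In (i) "α2=0", and in (iii) "α1=0", is claimed only when the limsup defining α1 (resp. α2) is a limit; the probability bounds of (i) and (iii) are stated assuming α2=0 (resp. α1=0), since alternating p_n = n^(-1/2), 1-n^(-1/2) refutes the original. *)

theory Defs
  imports "HOL-Probability.Probability" "HOL-Library.Ramsey"
begin

text \<open>The upper limits are taken in the extended reals, since they may be infinite.
  As they need not be limits, a positive \<open>alpha1 p\<close> does not by itself force \<open>alpha2 p = 0\<close>, nor
  conversely: let \<open>p n\<close> alternate between \<open>n powr (-1/2)\<close> and \<open>1 - n powr (-1/2)\<close>.\<close>

definition log_ratio1 :: "(nat \<Rightarrow> real) \<Rightarrow> nat \<Rightarrow> ereal" where
  "log_ratio1 p n = ereal (ln (1 / p n) / ln (real n))"

definition log_ratio2 :: "(nat \<Rightarrow> real) \<Rightarrow> nat \<Rightarrow> ereal" where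
  "log_ratio2 p n = ereal (ln (1 / (1 - p n)) / ln (real n))"

definition alpha1 :: "(nat \<Rightarrow> real) \<Rightarrow> ereal" where
  "alpha1 p = limsup (log_ratio1 p)"

definition alpha2 :: "(nat \<Rightarrow> real) \<Rightarrow> ereal" where
  "alpha2 p = limsup (log_ratio2 p)"

text \<open>The diagonal values \<open>P i i\<close> and values outside \<open>{1..n}\<close> carry no information.\<close>

definition edge_probs :: "nat \<Rightarrow> (nat \<Rightarrow> nat \<Rightarrow> real) \<Rightarrow> bool" where
  "edge_probs n P \<longleftrightarrow>
     (\<forall>i\<in>{1..n}. \<forall>j\<in>{1..n}. i \<noteq> j \<longrightarrow> P i j \<in> {0..1} \<and> P i j = P j i)"

text \<open>The infima are extended real, so that an infimum over no admissible \<open>S\<close> is \<open>\<infinity>\<close>. For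
  \<open>n \<ge> 1\<close> every admissible \<open>S\<close> is nonempty, as \<open>n powr a \<ge> 1\<close>.\<close>

definition min_average :: "real \<Rightarrow> nat \<Rightarrow> (nat \<Rightarrow> nat \<Rightarrow> real) \<Rightarrow> ereal" where
  "min_average a n P =
     (INF i\<in>{1..n}. INF S\<in>{S. S \<subseteq> {1..n} \<and> real n powr a \<le> real (card S) \<and> i \<notin> S}.
        ereal ((\<Sum>j\<in>S. P i j) / real (card S)))"

text \<open>Here \<open>P n\<close> is the vector of edge probabilities for the graph on \<open>n\<close> vertices, and \<open>N\<close> is
  the threshold from which on the averages are bounded below.\<close>

definition in_class :: "nat \<Rightarrow> real \<Rightarrow> (nat \<Rightarrow> real) \<Rightarrow> (nat \<Rightarrow> nat \<Rightarrow> nat \<Rightarrow> real) \<Rightarrow> bool" where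
  "in_class N a p P \<longleftrightarrow>
     (\<forall>n\<ge>1. edge_probs n (P n)) \<and> (\<forall>n\<ge>N. ereal (p n) \<le> min_average a n (P n))"

text \<open>A graph on \<open>{1..n}\<close> is represented by its set of edges, each edge being a two-element
  set. By symmetry of \<open>P\<close>, the probability of an edge may be read off as \<open>P (Min e) (Max e)\<close>.\<close>

definition random_graph :: "nat \<Rightarrow> (nat \<Rightarrow> nat \<Rightarrow> real) \<Rightarrow> nat set set pmf" where
  "random_graph n P =
     map_pmf (\<lambda>f. {e \<in> nsets {1..n} 2. f e})
       (Pi_pmf (nsets {1..n} 2) False (\<lambda>e. bernoulli_pmf (P (Min e) (Max e))))"

definition clique_number :: "nat \<Rightarrow> nat set set \<Rightarrow> nat" where
  "clique_number n E = Max {card C | C. C \<subseteq> {1..n} \<and> nsets C 2 \<subseteq> E}"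

definition prob_clique_ge :: "nat \<Rightarrow> (nat \<Rightarrow> nat \<Rightarrow> real) \<Rightarrow> real \<Rightarrow> real" where
  "prob_clique_ge n P x =
     measure_pmf.prob (random_graph n P) {E. x \<le> real (clique_number n E)}"

end

theory Submission
  imports Defs "HOL-Real_Asymp.Real_Asymp"
begin

text \<open>Let \<open>t = p powr (1 + \<theta>)\<close> with \<open>\<theta>\<close> small. In a set of \<open>m \<ge> n powr a + 1\<close> vertices the expected
  edge density is at least \<open>p\<close>, so by Chernoff it is below \<open>t\<close> only with probability
  \<open>exp (- c * p * (1 - p) * m\<^sup>2)\<close>; otherwise some vertex has at least \<open>t * (m - 1)\<close> neighbours in
  the set. The edges inside this neighbourhood are independent of the neighbourhood itself, so the
  search for a clique can be repeated there at the cost of a union bound over the vertex. With a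
  target of \<open>x = (1 - \<alpha>\<^sub>2 - \<eta>) * ln n / ln (1 / p)\<close> vertices, all sets that matter have size at least
  \<open>n powr (\<alpha>\<^sub>2 + \<eta> - \<theta>) / (2 * p)\<close>. As \<open>1 - p \<ge> n powr - (\<alpha>\<^sub>2 + \<theta>)\<close> eventually, this yields the
  exponent \<open>2 * \<eta> + \<alpha>\<^sub>2\<close> up to an error that vanishes with \<open>\<theta>\<close>, while the union bounds only
  contribute \<open>x * ln n\<close>, of order at most \<open>n powr (\<alpha>\<^sub>2 + 2 * \<theta>)\<close>. All three parts are instances of
  this estimate, with \<open>\<alpha>\<^sub>2 = 0\<close> in the first two.\<close>

section \<open>Counting edges through degrees\<close>

text \<open>Every edge is seen from both of its endpoints. The weight \<open>g\<close> is arbitrary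
  because edge indicators, edge probabilities and the constant 1 all occur.\<close>

lemma handshake:
  fixes g :: "'a set \<Rightarrow> real"
  assumes "finite S"
  shows "(\<Sum>i\<in>S. \<Sum>j\<in>S - {i}. g {i, j}) = 2 * (\<Sum>e\<in>nsets S 2. g e)"
  using assms
proof (induction S rule: finite_induct)
  case empty
  show ?case by (simp add: nsets_2_eq)
next
  case (insert x S)
  have split: "nsets (insert x S) 2 = nsets S 2 \<union> (\<lambda>j. {x, j}) ` S"
    using nsets_disjoint_2[of "{x}" S] insert.hyps by (auto simp: nsets_2_eq[of "{x}"])
  have disj: "nsets S 2 \<inter> (\<lambda>j. {x, j}) ` S = {}"
    using insert.hyps by (auto simp: nsets_def)
  have inj: "inj_on (\<lambda>j. {x, j}) S"
    by (auto simp: inj_on_def doubleton_eq_iff)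
  have R: "(\<Sum>e\<in>nsets (insert x S) 2. g e) = (\<Sum>e\<in>nsets S 2. g e) + (\<Sum>j\<in>S. g {x, j})"
    unfolding split using insert.hyps disj inj
    by (subst sum.union_disjoint) (auto simp: finite_imp_finite_nsets sum.reindex)
  have L: "(\<Sum>j\<in>insert x S - {i}. g {i, j}) = g {x, i} + (\<Sum>j\<in>S - {i}. g {i, j})" if "i \<in> S" for i
  proof -
    have "insert x S - {i} = insert x (S - {i})" using that insert.hyps by auto
    then show ?thesis using insert.hyps by (simp add: insert_commute)
  qed
  have "insert x S - {x} = S" using insert.hyps by auto
  then have "(\<Sum>i\<in>insert x S. \<Sum>j\<in>insert x S - {i}. g {i, j})
      = (\<Sum>j\<in>S. g {x, j}) + (\<Sum>i\<in>S. g {x, i} + (\<Sum>j\<in>S - {i}. g {i, j}))"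
    using insert.hyps L by simp
  then show ?case using R insert.IH by (simp add: sum.distrib)
qed

lemma card_nsets_2:
  "finite S \<Longrightarrow> 2 * real (card (nsets S 2)) = real (card S) * (real (card S) - 1)"
  using handshake[of S "\<lambda>_. 1"] by (cases "S = {}") (auto simp: of_nat_diff card_gt_0_iff Suc_leI)

section \<open>Independence and exponential bounds for product measures\<close>

text \<open>A draw on \<open>I\<close> arises by gluing independent draws on \<open>A\<close> and
  \<open>I - A\<close>; \<open>X\<close> reads only the first and \<open>Y\<close> only the
  second.\<close>

lemma prob_Pi_pmf_indep:
  assumes I: "finite I" and AB: "A \<subseteq> I" "B \<subseteq> I" "A \<inter> B = {}"
    and X: "\<And>f g. (\<And>e. e \<in> A \<Longrightarrow> f e = g e) \<Longrightarrow> f \<in> X \<longleftrightarrow> g \<in> X"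
    and Y: "\<And>f g. (\<And>e. e \<in> B \<Longrightarrow> f e = g e) \<Longrightarrow> f \<in> Y \<longleftrightarrow> g \<in> Y"
  shows "measure_pmf.prob (Pi_pmf I d p) (X \<inter> Y)
    = measure_pmf.prob (Pi_pmf I d p) X * measure_pmf.prob (Pi_pmf I d p) Y"
proof -
  let ?h = "\<lambda>(f, g) x. if x \<in> A then f x else g x"
  let ?P = "Pi_pmf A d p" and ?Q = "Pi_pmf (I - A) d p"
  have eq: "Pi_pmf I d p = map_pmf ?h (pair_pmf ?P ?Q)"
    using Pi_pmf_union[of A "I - A" d p] I AB by (auto simp: Un_absorb1 dest: finite_subset)
  have hX: "?h (f, g) \<in> X \<longleftrightarrow> f \<in> X" for f g by (rule X) auto
  have hY: "?h (f, g) \<in> Y \<longleftrightarrow> g \<in> Y" for f g using AB by (intro Y) auto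
  have vX: "?h -` X = X \<times> UNIV" and vY: "?h -` Y = UNIV \<times> Y" using hX hY by auto
  have vXY: "?h -` (X \<inter> Y) = X \<times> Y" by (simp only: vimage_Int vX vY) auto
  have prod: "measure_pmf.prob (pair_pmf ?P ?Q) (U \<times> V)
      = measure_pmf.prob ?P U * measure_pmf.prob ?Q V" for U V
  proof -
    have "measure_pmf.prob (pair_pmf ?P ?Q) (U \<times> V)
        = measure_pmf.prob (pair_pmf ?P ?Q) ((U \<inter> set_pmf ?P) \<times> (V \<inter> set_pmf ?Q))"
      by (rule measure_pmf.finite_measure_eq_AE) (auto simp: AE_measure_pmf_iff)
    also have "\<dots> = measure_pmf.prob ?P (U \<inter> set_pmf ?P) * measure_pmf.prob ?Q (V \<inter> set_pmf ?Q)"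
      by (rule measure_pmf_prob_product) (auto simp: countable_set_pmf)
    finally show ?thesis by (simp add: measure_Int_set_pmf)
  qed
  show ?thesis
    unfolding eq measure_map_pmf vXY vX vY prod by simp
qed

text \<open>Markov's inequality for \<open>exp (- l * k)\<close>, where \<open>k\<close> counts the
  successes in \<open>J\<close>; its expectation factorises by independence.\<close>

lemma prob_few_le:
  fixes w :: "'a \<Rightarrow> real"
  assumes I: "finite I" and J: "J \<subseteq> I" and w: "\<And>e. e \<in> I \<Longrightarrow> 0 \<le> w e \<and> w e \<le> 1"
    and l: "l > 0"
  shows "measure_pmf.prob (Pi_pmf I False (\<lambda>e. bernoulli_pmf (w e)))
           {f. (\<Sum>e\<in>J. of_bool (f e)) \<le> (s::real)}
         \<le> exp (l * s) * (\<Prod>e\<in>J. w e * exp (- l) + (1 - w e))"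
proof -
  let ?M = "Pi_pmf I False (\<lambda>e. bernoulli_pmf (w e))"
  \<comment> \<open>Coordinates outside \<open>J\<close> get the factor 1, so that the product can
    run over all of \<open>I\<close>.\<close>
  let ?F = "\<lambda>e (b::bool). if e \<in> J then exp (- l * of_bool b) else 1 :: real"
  have fJ: "finite J" using I J by (rule rev_finite_subset)
  have fin: "finite (set_pmf ?M)"
    using I by (auto simp: set_Pi_pmf intro!: finite_PiE_dflt)
  have F: "(\<Prod>e\<in>I. ?F e (f e)) = exp (- l * (\<Sum>e\<in>J. of_bool (f e)))" for f
  proof -
    have "(\<Prod>e\<in>I. ?F e (f e)) = (\<Prod>e\<in>J. exp (- l * of_bool (f e)))"
      using I J by (intro prod.mono_neutral_cong_right) auto
    also have "\<dots> = exp (\<Sum>e\<in>J. - l * of_bool (f e))" by (rule exp_sum[OF fJ, symmetric])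
    finally show ?thesis by (simp only: sum_distrib_left)
  qed
  have "measure_pmf.prob ?M {f. (\<Sum>e\<in>J. of_bool (f e)) \<le> s}
      = measure_pmf.prob ?M {f \<in> space ?M. (\<Prod>e\<in>I. ?F e (f e)) \<ge> exp (- l * s)}"
    unfolding F using l by (intro arg_cong[where f = "measure_pmf.prob ?M"]) auto
  also have "\<dots> \<le> (\<integral>f. (\<Prod>e\<in>I. ?F e (f e)) \<partial>?M) / exp (- l * s)"
    by (rule integral_Markov_inequality_measure)
       (auto intro!: integrable_measure_pmf_finite fin prod_nonneg)
  also have "(\<integral>f. (\<Prod>e\<in>I. ?F e (f e)) \<partial>?M)
    = (\<Prod>e\<in>I. measure_pmf.expectation (bernoulli_pmf (w e)) (?F e))"
    by (rule expectation_prod_Pi_pmf) (auto intro!: integrable_measure_pmf_finite I)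
  also have "\<dots> = (\<Prod>e\<in>J. w e * exp (- l) + (1 - w e))"
    using I J w by (intro prod.mono_neutral_cong_right) auto
  finally show ?thesis by (simp add: exp_minus divide_simps mult_ac)
qed

text \<open>The first alternative for \<open>D\<close> is the Chernoff bound for the number of successes, sharp for
  small \<open>p\<close>; the second one is the bound for the number of failures, sharp for \<open>p\<close> near 1.\<close>

lemma prob_few_le_exp:
  fixes w :: "'a \<Rightarrow> real" and p t :: real
  assumes I: "finite I" and J: "J \<subseteq> I" and w: "\<And>e. e \<in> I \<Longrightarrow> 0 \<le> w e \<and> w e \<le> 1"
    and avg: "p * real (card J) \<le> (\<Sum>e\<in>J. w e)" and l: "l > 0"
    and D: "l * t - (1 - exp (- l)) * p \<le> - D \<or> l * t - l + (exp l - 1) * (1 - p) \<le> - D"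
  shows "measure_pmf.prob (Pi_pmf I False (\<lambda>e. bernoulli_pmf (w e)))
           {f. (\<Sum>e\<in>J. of_bool (f e)) \<le> t * real (card J)} \<le> exp (- D * real (card J))"
proof -
  have fJ: "finite J" using I J by (rule rev_finite_subset)
  \<comment> \<open>Both alternatives for \<open>D\<close> come down to bounding the logarithm of
    each factor by some \<open>u e\<close> whose sum is at most \<open>U\<close> times the size of
    \<open>J\<close>.\<close>
  have *: "exp (l * (t * real (card J))) * (\<Prod>e\<in>J. w e * exp (- l) + (1 - w e))
    \<le> exp (- D * real (card J))"
    if le: "\<And>e. e \<in> J \<Longrightarrow> w e * exp (- l) + (1 - w e) \<le> exp (u e)"
      and S: "(\<Sum>e\<in>J. u e) \<le> U * real (card J)" and U: "l * t + U \<le> - D" for u U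
  proof -
    have "(\<Prod>e\<in>J. w e * exp (- l) + (1 - w e)) \<le> (\<Prod>e\<in>J. exp (u e))"
      using J w le by (intro prod_mono) (auto intro!: add_nonneg_nonneg)
    also have "\<dots> \<le> exp (U * real (card J))"
      using S by (simp add: exp_sum[OF fJ, symmetric])
    finally have "exp (l * (t * real (card J))) * (\<Prod>e\<in>J. w e * exp (- l) + (1 - w e))
        \<le> exp (l * (t * real (card J))) * exp (U * real (card J))" by (rule mult_left_mono) simp
    also have "\<dots> = exp ((l * t + U) * real (card J))"
      by (simp add: exp_add[symmetric] algebra_simps)
    also have "\<dots> \<le> exp (- D * real (card J))"
      using U by (intro iffD2[OF exp_le_cancel_iff] mult_right_mono) auto
    finally show ?thesis .
  qed
  have "exp (l * (t * real (card J))) * (\<Prod>e\<in>J. w e * exp (- l) + (1 - w e))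
    \<le> exp (- D * real (card J))"
    using D
  proof
    assume D: "l * t - (1 - exp (- l)) * p \<le> - D"
    show ?thesis
    proof (rule *)
      show "w e * exp (- l) + (1 - w e) \<le> exp (- (1 - exp (- l)) * w e)" for e
        using exp_ge_add_one_self[of "- (1 - exp (- l)) * w e"] by (simp add: algebra_simps)
      have "(1 - exp (- l)) * (p * real (card J)) \<le> (1 - exp (- l)) * (\<Sum>e\<in>J. w e)"
        using avg l by (intro mult_left_mono) auto
      then show "(\<Sum>e\<in>J. - (1 - exp (- l)) * w e) \<le> - (1 - exp (- l)) * p * real (card J)"
        by (simp only: sum_distrib_left[symmetric])
      show "l * t + - (1 - exp (- l)) * p \<le> - D" using D by (simp add: algebra_simps)
    qed
  next
    assume D: "l * t - l + (exp l - 1) * (1 - p) \<le> - D"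
    show ?thesis
    proof (rule *)
      fix e
      \<comment> \<open>Factoring out \<open>exp (- l)\<close>, the value at a sure success, leaves
        the failure probability \<open>1 - w e\<close>, to which \<open>1 + x \<le> exp x\<close>
        applies.\<close>
      have "w e * exp (- l) + (1 - w e) = exp (- l) * (1 + (exp l - 1) * (1 - w e))"
        by (simp add: algebra_simps exp_minus)
      also have "\<dots> \<le> exp (- l) * exp ((exp l - 1) * (1 - w e))"
        by (intro mult_left_mono exp_ge_add_one_self) auto
      finally show "w e * exp (- l) + (1 - w e) \<le> exp (- l + (exp l - 1) * (1 - w e))"
        by (simp only: exp_add)
    next
      have "(exp l - 1) * (real (card J) - (\<Sum>e\<in>J. w e))
        \<le> (exp l - 1) * (real (card J) - p * real (card J))"
        using avg l by (intro mult_left_mono) auto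
      then show "(\<Sum>e\<in>J. - l + (exp l - 1) * (1 - w e))
        \<le> (- l + (exp l - 1) * (1 - p)) * real (card J)"
        by (simp add: sum.distrib sum_distrib_left[symmetric] sum_subtractf algebra_simps)
      show "l * t + (- l + (exp l - 1) * (1 - p)) \<le> - D" using D by simp
    qed
  qed
  with prob_few_le[where w = w and s = "t * real (card J)", OF I J w l] show ?thesis by linarith
qed

section \<open>Growing cliques inside neighbourhoods\<close>

text \<open>The graph is an edge indicator \<open>f\<close> rather than an edge set, since the
  product measure lives on such functions.\<close>

definition has_clique :: "('a set \<Rightarrow> bool) \<Rightarrow> 'a set \<Rightarrow> nat \<Rightarrow> bool" where
  "has_clique f S L \<longleftrightarrow> (\<exists>C\<subseteq>S. finite C \<and> card C = L \<and> (\<forall>e\<in>nsets C 2. f e))"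

definition nbrs :: "('a set \<Rightarrow> bool) \<Rightarrow> 'a set \<Rightarrow> 'a \<Rightarrow> 'a set" where
  "nbrs f S i = {j \<in> S - {i}. f {i, j}}"

lemma has_clique_Suc:
  assumes "i \<in> S" "has_clique f (nbrs f S i) L"
  shows "has_clique f S (Suc L)"
proof -
  obtain C where C: "C \<subseteq> nbrs f S i" "finite C" "card C = L" "\<forall>e\<in>nsets C 2. f e"
    using assms(2) by (auto simp: has_clique_def)
  have i: "i \<notin> C" using C(1) by (auto simp: nbrs_def)
  have "nsets (insert i C) 2 = nsets C 2 \<union> (\<lambda>j. {i, j}) ` C"
    using nsets_disjoint_2[of "{i}" C] i by (auto simp: nsets_2_eq[of "{i}"])
  then have "\<forall>e\<in>nsets (insert i C) 2. f e" using C by (auto simp: nbrs_def)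
  moreover have "insert i C \<subseteq> S" using C(1) assms(1) by (auto simp: nbrs_def)
  ultimately show ?thesis
    using C i unfolding has_clique_def by (intro exI[of _ "insert i C"]) auto
qed

text \<open>Used contrapositively: by \<open>handshake\<close>, an edge density above
  \<open>t\<close> forces a vertex with more than \<open>t * (m - 1)\<close> neighbours,
  \<open>m\<close> being the size of \<open>S\<close>.\<close>

lemma few_edges_if_small_degrees:
  assumes S: "finite S" and d: "\<And>i. i \<in> S \<Longrightarrow> real (card (nbrs f S i)) \<le> t * (real (card S) - 1)"
  shows "(\<Sum>e\<in>nsets S 2. of_bool (f e)) \<le> t * real (card (nsets S 2))"
proof -
  have deg: "(\<Sum>j\<in>S - {i}. of_bool (f {i, j})) = real (card (nbrs f S i))" for i
    using S by (simp add: nbrs_def Int_def)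
  have "2 * (\<Sum>e\<in>nsets S 2. of_bool (f e)) = (\<Sum>i\<in>S. real (card (nbrs f S i)))"
    using handshake[OF S, of "\<lambda>e. of_bool (f e)"] unfolding deg by simp
  also have "\<dots> \<le> (\<Sum>i\<in>S. t * (real (card S) - 1))" using d by (rule sum_mono)
  also have "\<dots> = t * (2 * real (card (nsets S 2)))" unfolding card_nsets_2[OF S] by simp
  finally show ?thesis by simp
qed

text \<open>The neighbourhood of \<open>i\<close> is independent of the edges avoiding \<open>i\<close>, so one may condition
  on it.\<close>

lemma prob_no_clique_in_nbrs:
  fixes w :: "'a set \<Rightarrow> real"
  assumes V: "finite V" and S: "S \<subseteq> V" and i: "i \<in> S" and u: "u \<ge> 0"
    and T: "\<And>T. T \<subseteq> S - {i} \<Longrightarrow> d \<le> real (card T) \<Longrightarrow>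
       measure_pmf.prob (Pi_pmf (nsets V 2) False q) {f. \<not> has_clique f T L} \<le> u"
  shows "measure_pmf.prob (Pi_pmf (nsets V 2) False q)
     {f. d \<le> real (card (nbrs f S i)) \<and> \<not> has_clique f (nbrs f S i) L} \<le> u"
proof -
  let ?M = "Pi_pmf (nsets V 2) False q"
  define \<T> where "\<T> = {T. T \<subseteq> S - {i} \<and> d \<le> real (card T)}"
  have fS: "finite S" using V S by (rule rev_finite_subset)
  have f\<T>: "finite \<T>" unfolding \<T>_def by (rule finite_subset[of _ "Pow S"]) (use fS in auto)
  have indep: "measure_pmf.prob ?M ({f. nbrs f S i = T} \<inter> {f. \<not> has_clique f T L})
      = measure_pmf.prob ?M {f. nbrs f S i = T} * measure_pmf.prob ?M {f. \<not> has_clique f T L}"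
    if "T \<in> \<T>" for T
  proof (rule prob_Pi_pmf_indep[where A = "(\<lambda>j. {i, j}) ` (S - {i})" and B = "nsets (S - {i}) 2"])
    show "finite (nsets V 2)" using V by (rule finite_imp_finite_nsets)
    show "(\<lambda>j. {i, j}) ` (S - {i}) \<subseteq> nsets V 2" using S i by auto
    show "nsets (S - {i}) 2 \<subseteq> nsets V 2" using S by (intro nsets_mono) auto
    show "(\<lambda>j. {i, j}) ` (S - {i}) \<inter> nsets (S - {i}) 2 = {}" by (auto simp: nsets_def)
    show "f \<in> {f. nbrs f S i = T} \<longleftrightarrow> g \<in> {f. nbrs f S i = T}"
      if "\<And>e. e \<in> (\<lambda>j. {i, j}) ` (S - {i}) \<Longrightarrow> f e = g e" for f g
    proof -
      have "nbrs f S i = nbrs g S i" using that by (auto simp: nbrs_def)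
      then show ?thesis by simp
    qed
    show "f \<in> {f. \<not> has_clique f T L} \<longleftrightarrow> g \<in> {f. \<not> has_clique f T L}"
      if eq: "\<And>e. e \<in> nsets (S - {i}) 2 \<Longrightarrow> f e = g e" for f g
    proof -
      have "f e = g e" if "C \<subseteq> T" "e \<in> nsets C 2" for C e
      proof (rule eq)
        have "C \<subseteq> S - {i}" using that \<open>T \<in> \<T>\<close> by (auto simp: \<T>_def)
        then show "e \<in> nsets (S - {i}) 2" using nsets_mono that by blast
      qed
      then show ?thesis by (auto simp: has_clique_def)
    qed
  qed
  have sub: "nbrs f S i \<subseteq> S - {i}" for f by (auto simp: nbrs_def)
  \<comment> \<open>Split by the value \<open>T\<close> of the neighbourhood. These events are
    disjoint, so their probabilities, each multiplied by \<open>u\<close>, add up to at most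
    \<open>u\<close>.\<close>
  have "{f. d \<le> real (card (nbrs f S i)) \<and> \<not> has_clique f (nbrs f S i) L}
      = (\<Union>T\<in>\<T>. {f. nbrs f S i = T} \<inter> {f. \<not> has_clique f T L})"
    unfolding \<T>_def using sub by blast
  then have "measure_pmf.prob ?M {f. d \<le> real (card (nbrs f S i)) \<and> \<not> has_clique f (nbrs f S i) L}
      \<le> (\<Sum>T\<in>\<T>. measure_pmf.prob ?M ({f. nbrs f S i = T} \<inter> {f. \<not> has_clique f T L}))"
    using f\<T> by (simp only:) (rule measure_pmf.finite_measure_subadditive_finite, auto)
  also have "\<dots> \<le> (\<Sum>T\<in>\<T>. measure_pmf.prob ?M {f. nbrs f S i = T} * u)"
  proof (rule sum_mono)
    fix T assume T\<T>: "T \<in> \<T>"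
    then have "measure_pmf.prob ?M {f. \<not> has_clique f T L} \<le> u" by (intro T) (auto simp: \<T>_def)
    then show "measure_pmf.prob ?M ({f. nbrs f S i = T} \<inter> {f. \<not> has_clique f T L})
        \<le> measure_pmf.prob ?M {f. nbrs f S i = T} * u"
      unfolding indep[OF T\<T>] by (rule mult_left_mono) simp
  qed
  also have "\<dots> = (\<Sum>T\<in>\<T>. measure_pmf.prob ?M {f. nbrs f S i = T}) * u"
    by (simp add: sum_distrib_right)
  also have "(\<Sum>T\<in>\<T>. measure_pmf.prob ?M {f. nbrs f S i = T})
      = measure_pmf.prob ?M (\<Union>T\<in>\<T>. {f. nbrs f S i = T})"
    by (rule measure_pmf.finite_measure_finite_Union[symmetric])
      (use f\<T> in \<open>auto simp: disjoint_family_on_def\<close>)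
  also have "\<dots> * u \<le> 1 * u" using u by (intro mult_right_mono) auto
  finally show ?thesis by simp
qed

text \<open>Passing from \<open>S\<close> to a neighbourhood turns the size \<open>m\<close> into at least \<open>t * (m - 1)\<close>. The
  constant \<open>c\<close> is chosen so that \<open>m + c\<close> then shrinks exactly by the factor \<open>t\<close>.\<close>

lemma prob_no_clique_le:
  fixes t c B E :: real
  assumes V: "finite V" and t: "0 < t" "t < 1" and c: "c = t / (1 - t)"
    and B: "B > 1" and E: "E \<ge> 0"
    and few: "\<And>S. S \<subseteq> V \<Longrightarrow> B \<le> real (card S) \<Longrightarrow>
       measure_pmf.prob (Pi_pmf (nsets V 2) False q)
         {f. (\<Sum>e\<in>nsets S 2. of_bool (f e)) \<le> t * real (card (nsets S 2))} \<le> E"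
    and S: "S \<subseteq> V" "S \<noteq> {}" and L: "L \<ge> 1" "L \<ge> 2 \<Longrightarrow> B \<le> t ^ (L - 2) * (real (card S) + c) - c"
  shows "measure_pmf.prob (Pi_pmf (nsets V 2) False q) {f. \<not> has_clique f S L}
    \<le> (real (card V) + 1) ^ L * E"
  using L S
proof (induction L arbitrary: S rule: nat_induct_at_least)
  case base
  then obtain x where "x \<in> S" by auto
  then have "has_clique f S 1" for f
    unfolding has_clique_def
      by (intro exI[of _ "{x}"]) (auto simp: nsets_def card_1_singleton_iff dest: card_mono[rotated])
  then show ?case using E by simp
next
  case (Suc L)
  let ?M = "Pi_pmf (nsets V 2) False q" and ?m = "real (card S)"
  have fS: "finite S" using V Suc.prems by (auto dest: finite_subset)
  have c0: "c > 0" using t c by simp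
  \<comment> \<open>A clique of size \<open>Suc L\<close> uses the density bound \<open>L\<close>
    times, on sets that have shrunk at most \<open>L - 1\<close> times; the smallest of these must
    still have size \<open>B\<close>. The final vertex only asks for a nonempty set.\<close>
  have Bm: "B \<le> t ^ (L - 1) * (?m + c) - c" using Suc.prems(1) Suc.hyps by (simp add: Suc_diff_le)
  also have "\<dots> \<le> 1 * (?m + c) - c"
    using t c0 by (intro diff_right_mono mult_right_mono power_le_one) auto
  finally have m: "B \<le> ?m" by simp
  have shift: "t * (?m - 1) + c = t * (?m + c)" using t unfolding c by (simp add: field_simps)
  have nb: "measure_pmf.prob ?M {f. t * (?m - 1)
    \<le> real (card (nbrs f S i)) \<and> \<not> has_clique f (nbrs f S i) L}
      \<le> (real (card V) + 1) ^ L * E" if i: "i \<in> S" for i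
  proof (rule prob_no_clique_in_nbrs[OF V Suc.prems(2) i])
    fix T assume T: "T \<subseteq> S - {i}" "t * (?m - 1) \<le> real (card T)"
    \<comment> \<open>\<open>B > 1\<close> keeps the neighbourhood nonempty, which is enough for a
      clique of size 1.\<close>
    have "0 < t * (?m - 1)" using t m B by simp
    then have ne: "T \<noteq> {}" using T(2) by auto
    show "measure_pmf.prob ?M {f. \<not> has_clique f T L} \<le> (real (card V) + 1) ^ L * E"
    proof (rule Suc.IH)
      show "T \<subseteq> V" "T \<noteq> {}" using T Suc.prems ne by auto
      assume L2: "2 \<le> L"
      have "L - 1 = Suc (L - 2)" using L2 by simp
      then have "t ^ (L - 1) * (?m + c) = t ^ (L - 2) * (t * (?m - 1) + c)"
        unfolding shift by simp
      also have "\<dots> \<le> t ^ (L - 2) * (real (card T) + c)"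
        using T t by (intro mult_left_mono) auto
      finally show "B \<le> t ^ (L - 2) * (real (card T) + c) - c" using Bm by simp
    qed
  qed (use E in simp)
  have sub: "{f. \<not> has_clique f S (Suc L)}
      \<subseteq> {f. (\<Sum>e\<in>nsets S 2. of_bool (f e)) \<le> t * real (card (nsets S 2))} \<union>
        (\<Union>i\<in>S. {f. t * (?m - 1) \<le> real (card (nbrs f S i)) \<and> \<not> has_clique f (nbrs f S i) L})"
  proof
    fix f assume f: "f \<in> {f. \<not> has_clique f S (Suc L)}"
    show "f \<in> {f. (\<Sum>e\<in>nsets S 2. of_bool (f e)) \<le> t * real (card (nsets S 2))} \<union>
        (\<Union>i\<in>S. {f. t * (?m - 1) \<le> real (card (nbrs f S i)) \<and> \<not> has_clique f (nbrs f S i) L})"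
    proof (cases "\<exists>i\<in>S. t * (?m - 1) \<le> real (card (nbrs f S i))")
      case True
      then show ?thesis using f has_clique_Suc[of _ S f L] by blast
    next
      case False
      then show ?thesis using few_edges_if_small_degrees[OF fS, of f t] by fastforce
    qed
  qed
  have "measure_pmf.prob ?M {f. \<not> has_clique f S (Suc L)}
      \<le> measure_pmf.prob ?M {f. (\<Sum>e\<in>nsets S 2. of_bool (f e)) \<le> t * real (card (nsets S 2))}
       + (\<Sum>i\<in>S. measure_pmf.prob ?M {f. t * (?m - 1)
         \<le> real (card (nbrs f S i)) \<and> \<not> has_clique f (nbrs f S i) L})"
    by (rule order_trans[OF measure_pmf.finite_measure_mono[OF sub] order_trans[OF measure_Un_le]])
       (use fS in \<open>auto intro!: add_left_mono measure_pmf.finite_measure_subadditive_finite\<close>)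
  also have "\<dots> \<le> E + (\<Sum>i\<in>S. (real (card V) + 1) ^ L * E)"
    using few[OF Suc.prems(2) m] nb by (intro add_mono sum_mono) auto
  \<comment> \<open>The leading \<open>E\<close> is absorbed as one further copy of the term for a
    single vertex; hence the base \<open>card V + 1\<close>.\<close>
  also have "\<dots> \<le> (real (card V) + 1) ^ L * E + real (card V) * ((real (card V) + 1) ^ L * E)"
  proof -
    have "1 * E \<le> (real (card V) + 1) ^ L * E" using E by (intro mult_right_mono one_le_power) auto
    moreover have "real (card S) * ((real (card V) + 1) ^ L * E)
      \<le> real (card V) * ((real (card V) + 1) ^ L * E)"
      using E V Suc.prems by (intro mult_right_mono) (auto intro: card_mono)
    ultimately show ?thesis unfolding sum_constant by linarith
  qed
  also have "\<dots> = (real (card V) + 1) ^ Suc L * E" by (simp add: algebra_simps)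
  finally show ?case .
qed

section \<open>The Chernoff exponent and the comparison of growth rates\<close>

text \<open>Supplies the hypothesis \<open>D\<close> of \<open>prob_few_le_exp\<close> for
  \<open>t = p powr (1 + \<theta>)\<close>, with one constant for all \<open>p\<close>. For
  \<open>p \<le> 1/2\<close> the gap \<open>p - t\<close> is at least of order \<open>p\<close> and
  successes are counted; for larger \<open>p\<close> it is at least of order \<open>1 - p\<close>
  and failures are counted.\<close>

lemma chernoff_exponent:
  fixes \<theta> :: real
  assumes \<theta>: "\<theta> > 0"
  obtains c0 :: real where "c0 > 0"
    "\<And>p. 0 < p \<Longrightarrow> p < 1 \<Longrightarrow> \<exists>l>0.
       l * p powr (1 + \<theta>) - (1 - exp (- l)) * p \<le> - (c0 * p * (1 - p)) \<or>
       l * p powr (1 + \<theta>) - l + (exp l - 1) * (1 - p) \<le> - (c0 * p * (1 - p))"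
proof -
  \<comment> \<open>\<open>1 - d\<close> is the value of \<open>p powr \<theta>\<close> at
    \<open>p = 1/2\<close>, hence its maximum over \<open>p \<le> 1/2\<close>.\<close>
  define d :: real where "d = 1 - (1/2) powr \<theta>"
  have "(1/2) powr \<theta> < (1::real) powr \<theta>" using \<theta> by (intro powr_less_mono2) auto
  then have d: "0 < d" "d < 1" by (auto simp: d_def)
  \<comment> \<open>For \<open>p > 1/2\<close> the exponent is at most
    \<open>(l\<^sup>2 - l * d) * (1 - p)\<close>, which is smallest at \<open>l = d / 2\<close> and
    then equals \<open>- (d\<^sup>2 / 4) * (1 - p)\<close>. For \<open>p \<le> 1/2\<close>, taking
    \<open>l = d\<close> gives \<open>- (d\<^sup>2 / 2) * p\<close>.\<close>
  define c0 where "c0 = d\<^sup>2 / 4"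
  have c0: "c0 > 0" using d by (simp add: c0_def)
  show ?thesis
  proof (rule that[OF c0])
    fix p :: real assume p: "0 < p" "p < 1"
    show "\<exists>l>0. l * p powr (1 + \<theta>) - (1 - exp (- l)) * p \<le> - (c0 * p * (1 - p)) \<or>
       l * p powr (1 + \<theta>) - l + (exp l - 1) * (1 - p) \<le> - (c0 * p * (1 - p))"
    proof (cases "p \<le> 1/2")
      case True
      have e: "exp (- d) \<le> 1 - d + d\<^sup>2 / 2"
      proof -
        have "1 + d + d\<^sup>2 / 2 \<le> exp d" using exp_lower_Taylor_quadratic[of d] d by simp
        \<comment> \<open>The product equals \<open>1 + d ^ 4 / 4\<close>.\<close>
        moreover have "1 \<le> (1 - d + d\<^sup>2 / 2) * (1 + d + d\<^sup>2 / 2)"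
          using d by (simp add: algebra_simps power2_eq_square)
        moreover have "0 < 1 - d + d\<^sup>2 / 2" using d by (simp add: add_pos_nonneg)
        ultimately have "1 \<le> (1 - d + d\<^sup>2 / 2) * exp d"
          by (smt (verit) mult_left_mono)
        then show ?thesis by (simp add: exp_minus field_simps)
      qed
      have "p powr \<theta> \<le> (1/2) powr \<theta>" using True p \<theta> by (intro powr_mono2) auto
      then have "p powr (1 + \<theta>) \<le> p * (1 - d)" using p by (simp add: powr_add d_def)
      then have "d * p powr (1 + \<theta>) - (1 - exp (- d)) * p
        \<le> d * (p * (1 - d)) - (1 - (1 - d + d\<^sup>2 / 2)) * p"
        using e p d by (intro diff_mono mult_left_mono mult_right_mono) auto
      also have "\<dots> = - (d\<^sup>2 / 2 * p)" by (simp add: algebra_simps power2_eq_square)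
      also have "\<dots> \<le> - (c0 * p * (1 - p))"
      proof -
        have "p * (1 - p) \<le> p * 2" using p by (intro mult_left_mono) auto
        then have "c0 * (p * (1 - p)) \<le> c0 * (p * 2)"
          using c0 by (rule mult_left_mono[OF _ less_imp_le])
        moreover have "d\<^sup>2 / 2 * p = c0 * (p * 2)" by (simp add: c0_def)
        ultimately show ?thesis using p by (simp add: mult.assoc)
      qed
      finally show ?thesis using d by blast
    next
      case False
      txt \<open>By convexity, \<open>p powr (1 + \<theta>)\<close> lies below its chord over \<open>[1/2, 1]\<close>, of slope \<open>1 + d\<close>.\<close>
      have "((1 - (2 * p - 1)) *\<^sub>R (1 / 2) + (2 * p - 1) *\<^sub>R 1) powr (1 + \<theta>)
          \<le> (1 - (2 * p - 1)) * (1 / 2) powr (1 + \<theta>) + (2 * p - 1) * 1 powr (1 + \<theta>)"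
        using \<theta> p False by (intro convex_onD[OF powr_convex]) auto
      also have "(1 / 2 :: real) powr (1 + \<theta>) = (1 - d) / 2" by (simp add: powr_add d_def)
      also have "(1 - (2 * p - 1)) *\<^sub>R (1 / 2) + (2 * p - 1) *\<^sub>R 1 = p" by (simp add: algebra_simps)
      finally have "p powr (1 + \<theta>) \<le> 1 - (1 + d) * (1 - p)" by (simp add: field_simps)
      define l where "l = d / 2"
      have l: "0 < l" "l \<le> 1" using d by (auto simp: l_def)
      have el: "exp l \<le> 1 + l + l\<^sup>2" using exp_bound[of l] l by auto
      have "l * p powr (1 + \<theta>) - l + (exp l - 1) * (1 - p)
         \<le> l * (1 - (1 + d) * (1 - p)) - l + (l + l\<^sup>2) * (1 - p)"
        using el l p \<open>p powr (1 + \<theta>) \<le> _\<close>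
          by (intro add_mono diff_mono mult_left_mono mult_right_mono) auto
      also have "\<dots> = - (c0 * (1 - p))" by (simp add: l_def c0_def power2_eq_square field_simps)
      also have "\<dots> \<le> - (c0 * p * (1 - p))"
        using p c0 by (simp add: mult_le_cancel_left1 mult_right_mono)
      finally show ?thesis using l by blast
    qed
  qed
qed

text \<open>Only exponents matter: \<open>A + \<eta> - \<theta>\<close> exceeds
  \<open>A + \<theta>\<close>, \<open>b\<close> and 0, while
  \<open>2 * \<eta> + A - 3 * \<theta>\<close> exceeds \<open>\<kappa>\<close> and also
  \<open>A + \<theta>\<close>, by a positive margin that beats the logarithms.\<close>

lemma powr_bounds_eventually:
  fixes A \<eta> b \<kappa> \<theta> c :: real
  assumes A: "A \<ge> 0" and \<theta>: "\<theta> > 0" "2 * \<theta> < \<eta>" and b: "b < A + \<eta> - \<theta>"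
    and \<kappa>: "\<kappa> < 2 * \<eta> + A - 3 * \<theta>" and c: "c > 0"
  shows "\<forall>\<^sub>F n in sequentially.
      real n powr (A + \<theta>) \<le> real n powr (A + \<eta> - \<theta>) / 2 \<and>
      real n powr b \<le> real n powr (A + \<eta> - \<theta>) / 2 - 1 \<and>
      2 \<le> real n powr (A + \<eta> - \<theta>) / 2 \<and>
      (real n powr (A + \<theta>) * ln (real n) + 1) * ln (real n + 1) + real n powr \<kappa>
        \<le> c * real n powr (2 * \<eta> + A - 3 * \<theta>)"
proof (intro eventually_conj)
  show "\<forall>\<^sub>F n in sequentially. real n powr (A + \<theta>) \<le> real n powr (A + \<eta> - \<theta>) / 2"
    using \<theta> by real_asymp
  show "\<forall>\<^sub>F n in sequentially. real n powr b \<le> real n powr (A + \<eta> - \<theta>) / 2 - 1"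
    using \<theta> b A by real_asymp
  show "\<forall>\<^sub>F n in sequentially. 2 \<le> real n powr (A + \<eta> - \<theta>) / 2"
    using \<theta> A by real_asymp
  define s r where "s = A + \<theta>" and "r = 2 * \<eta> + A - 3 * \<theta>"
  have sr: "s > 0" "s < r" "\<kappa> < r" using assms by (auto simp: s_def r_def)
  have "\<forall>\<^sub>F n in sequentially. (real n powr s * ln (real n) + 1) * ln (real n + 1)
    \<le> c / 2 * real n powr r"
    using sr c by real_asymp
  moreover have "\<forall>\<^sub>F n in sequentially. real n powr \<kappa> \<le> c / 2 * real n powr r"
    using sr c by real_asymp
  ultimately show "\<forall>\<^sub>F n in sequentially. (real n powr (A + \<theta>) * ln (real n) + 1) * ln (real n + 1) + real n powr \<kappa>
        \<le> c * real n powr (2 * \<eta> + A - 3 * \<theta>)"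
    unfolding s_def r_def by eventually_elim linarith
qed

section \<open>From edge indicators and neighbourhood averages to the random graph\<close>

lemma clique_number_ge:
  assumes "has_clique f {1..n} L"
  shows "L \<le> clique_number n {e \<in> nsets {1..n} 2. f e}"
proof -
  let ?E = "{e \<in> nsets {1..n} 2. f e}"
  obtain C where C: "C \<subseteq> {1..n}" "card C = L" "\<forall>e\<in>nsets C 2. f e"
    using assms by (auto simp: has_clique_def)
  have "nsets C 2 \<subseteq> ?E" using C nsets_mono[of C "{1..n}" 2] by auto
  then have "L \<in> {card C | C. C \<subseteq> {1..n} \<and> nsets C 2 \<subseteq> ?E}" using C by auto
  moreover have "finite {card C | C. C \<subseteq> {1..n} \<and> nsets C 2 \<subseteq> ?E}"
    by (rule finite_subset[of _ "card ` Pow {1..n}"]) auto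
  ultimately show ?thesis unfolding clique_number_def by (rule Max_ge[rotated])
qed

lemma prob_clique_ge_lower:
  assumes "x \<le> real L"
  shows "prob_clique_ge n P x \<ge> 1 - measure_pmf.prob
    (Pi_pmf (nsets {1..n} 2) False (\<lambda>e. bernoulli_pmf (P (Min e) (Max e)))) {f. \<not> has_clique f {1..n} L}"
proof -
  let ?M = "Pi_pmf (nsets {1..n} 2) False (\<lambda>e. bernoulli_pmf (P (Min e) (Max e)))"
  have "1 - measure_pmf.prob ?M {f. \<not> has_clique f {1..n} L}
    = measure_pmf.prob ?M {f. has_clique f {1..n} L}"
    using measure_pmf.prob_compl[of "{f. has_clique f {1..n} L}" ?M]
      by (simp add: Compl_eq_Diff_UNIV[symmetric] Collect_neg_eq)
  also have "\<dots> \<le> prob_clique_ge n P x"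
    unfolding prob_clique_ge_def random_graph_def measure_map_pmf
  proof (rule measure_pmf.finite_measure_mono)
    show "{f. has_clique f {1..n} L}
        \<subseteq> (\<lambda>f. {e \<in> nsets {1..n} 2. f e}) -` {E. x \<le> real (clique_number n E)}"
      using clique_number_ge[of _ n L] assms by (force intro: order_trans)
  qed simp
  finally show ?thesis .
qed

lemma in_class_average:
  assumes "in_class N a p P" "n \<ge> N" "i \<in> {1..n}" "S \<subseteq> {1..n}" "i \<notin> S"
    and S: "real n powr a \<le> real (card S)" "S \<noteq> {}"
  shows "p n * real (card S) \<le> (\<Sum>j\<in>S. P n i j)"
proof -
  have "ereal (p n) \<le> min_average a n (P n)" using assms by (auto simp: in_class_def)
  also have "\<dots> \<le> ereal ((\<Sum>j\<in>S. P n i j) / real (card S))"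
    unfolding min_average_def using assms by (intro INF_lower2[of i] INF_lower) auto
  finally have "p n \<le> (\<Sum>j\<in>S. P n i j) / real (card S)" by simp
  moreover have "card S > 0" using assms(4) S(2) by (auto simp: card_gt_0_iff dest: finite_subset)
  ultimately show ?thesis by (simp add: field_simps)
qed

text \<open>The class condition speaks of one vertex at a time; using it on \<open>S - {i}\<close>
  for every \<open>i\<close> in \<open>S\<close> and summing gives the mean edge density that the
  Chernoff bound asks for. Symmetry of \<open>P\<close> lets both endpoints of an edge see the same
  probability.\<close>

lemma edge_sum_ge:
  assumes P: "edge_probs n P" and S: "S \<subseteq> {1..n}"
    and avg: "\<And>i. i \<in> S \<Longrightarrow> p * real (card (S - {i})) \<le> (\<Sum>j\<in>S - {i}. P i j)"
  shows "p * real (card (nsets S 2)) \<le> (\<Sum>e\<in>nsets S 2. P (Min e) (Max e))"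
proof -
  have fS: "finite S" using S by (auto dest: finite_subset)
  have sym: "P (Min {i, j}) (Max {i, j}) = P i j" if "i \<in> S" "j \<in> S - {i}" for i j
    using P S that by (auto simp: edge_probs_def subset_iff min_def max_def)
  have deg: "real (card (S - {i})) = real (card S) - 1" if "i \<in> S" for i
    using card_Suc_Diff1[OF fS that] by linarith
  have "p * (2 * real (card (nsets S 2))) = (\<Sum>i\<in>S. p * real (card (S - {i})))"
    unfolding card_nsets_2[OF fS] using deg by (simp cong: sum.cong)
  also have "\<dots> \<le> (\<Sum>i\<in>S. \<Sum>j\<in>S - {i}. P i j)" using avg by (rule sum_mono)
  also have "\<dots> = (\<Sum>i\<in>S. \<Sum>j\<in>S - {i}. P (Min {i, j}) (Max {i, j}))"
    using sym by (intro sum.cong refl) auto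
  also have "\<dots> = 2 * (\<Sum>e\<in>nsets S 2. P (Min e) (Max e))" by (rule handshake[OF fS])
  finally show ?thesis by simp
qed

lemma edge_probs_edge:
  assumes "edge_probs n P" "e \<in> nsets {1..n} 2"
  shows "0 \<le> P (Min e) (Max e) \<and> P (Min e) (Max e) \<le> 1"
  using assms by (auto simp: edge_probs_def min_def max_def elim!: nsets2_E)

section \<open>The estimate for a fixed number of vertices\<close>

text \<open>The asymptotics enter as hypotheses on \<open>n\<close>: \<open>n1\<close> absorbs the
  constant \<open>c\<close> of \<open>prob_no_clique_le\<close>, \<open>n2\<close> makes the
  averages available on all sets that matter, \<open>n3\<close> gives \<open>B \<ge> 2\<close>, and
  \<open>n4\<close> lets the Chernoff exponent outweigh the union bounds.\<close>

lemma prob_clique_ge_bound: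
  fixes p A \<eta> b \<kappa> \<theta> c0 :: real
  assumes A: "A \<ge> 0" and \<eta>: "\<eta> > 0" "A + \<eta> < 1" and \<theta>: "\<theta> > 0" and c0: "c0 > 0" and n: "n \<ge> 2"
    and p: "0 < p" "p < 1" and q: "real n powr - (A + \<theta>) \<le> 1 - p"
    and chernoff: "\<exists>l>0.
       l * p powr (1 + \<theta>) - (1 - exp (- l)) * p \<le> - (c0 * p * (1 - p)) \<or>
       l * p powr (1 + \<theta>) - l + (exp l - 1) * (1 - p) \<le> - (c0 * p * (1 - p))"
    and n1: "real n powr (A + \<theta>) \<le> real n powr (A + \<eta> - \<theta>) / 2"
    and n2: "real n powr b \<le> real n powr (A + \<eta> - \<theta>) / 2 - 1"
    and n3: "2 \<le> real n powr (A + \<eta> - \<theta>) / 2"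
    and n4: "(real n powr (A + \<theta>) * ln (real n) + 1) * ln (real n + 1) + real n powr \<kappa>
        \<le> c0 / 16 * real n powr (2 * \<eta> + A - 3 * \<theta>)"
    and P: "edge_probs n P"
    and avg: "\<And>i S. i \<in> {1..n} \<Longrightarrow> S \<subseteq> {1..n} \<Longrightarrow> i \<notin> S \<Longrightarrow> S \<noteq> {} \<Longrightarrow> real n powr b \<le> real (card S) \<Longrightarrow>
       p * real (card S) \<le> (\<Sum>j\<in>S. P i j)"
  shows "1 - exp (- (real n powr \<kappa>))
    \<le> prob_clique_ge n P ((1 - A - \<eta>) * (ln (real n) / ln (1 / p)))"
proof -
  define x where "x = (1 - A - \<eta>) * (ln (real n) / ln (1 / p))"
  let ?M = "Pi_pmf (nsets {1..n} 2) False (\<lambda>e. bernoulli_pmf (P (Min e) (Max e)))"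
  have lnp: "ln p < 0" using p by simp
  have lnn: "ln (real n) > 0" using n by simp
  have x: "x * ln p = - (1 - A - \<eta>) * ln (real n)"
    unfolding x_def using lnp p by (simp add: ln_div field_simps)
  show ?thesis
  proof (cases "x \<le> 1")
    case True
    have "has_clique f {1..n} 1" for f
      unfolding has_clique_def
        using n by (intro exI[of _ "{1}"]) (auto simp: nsets_def dest: card_mono[rotated])
    then have "prob_clique_ge n P x \<ge> 1" using prob_clique_ge_lower[of x 1 n P] True by simp
    moreover have "1 - exp (- (real n powr \<kappa>)) \<le> 1" by simp
    ultimately show ?thesis unfolding x_def by linarith
  next
    case False
    define L where "L = nat \<lceil>x\<rceil>"
    have L: "2 \<le> L" "x \<le> real L" "real L < x + 1" using False by (auto simp: L_def) linarith+
    define t where "t = p powr (1 + \<theta>)"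
    have t: "0 < t" "t < 1" "t \<le> p"
      using p \<theta> powr_mono'[of 1 "1 + \<theta>" p] by (auto simp: t_def)
    \<comment> \<open>Half of the lower bound in \<open>tL\<close> below; the other half pays for
      \<open>c\<close>. The factor \<open>1 / p\<close> compensates the factor \<open>p\<close> in
      the Chernoff exponent.\<close>
    define B where "B = real n powr (A + \<eta> - \<theta>) / (2 * p)"
    have "real n powr (A + \<eta> - \<theta>) / 2 \<le> B"
      using p unfolding B_def by (intro divide_left_mono) auto
    then have B: "2 \<le> B" "real n powr b \<le> B - 1" using n2 n3 by auto
    have "1 / (1 - p) \<le> 1 / real n powr - (A + \<theta>)"
      using p q n by (intro divide_left_mono) auto
    also have "\<dots> = real n powr (A + \<theta>)"
      by (simp only: powr_minus divide_inverse inverse_inverse_eq mult_1)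
    finally have q0: "0 < 1 - p" "1 / (1 - p) \<le> real n powr (A + \<theta>)"
      using p by auto
    txt \<open>Since \<open>L - 2 \<le> x - 1\<close>, one factor \<open>1 / p\<close> is gained over \<open>p powr x = n powr - (1 - A - \<eta>)\<close>.\<close>
    have tL: "real n powr (A + \<eta> - \<theta>) / p \<le> t ^ (L - 2) * real n"
    proof -
      have "(1 + \<theta>) * (x - 1) * ln p = - (1 - A - \<eta>) * ln (real n) * (1 + \<theta>) - (1 + \<theta>) * ln p"
        unfolding x[symmetric] by (simp add: algebra_simps)
      \<comment> \<open>This bound and the next say that passing from \<open>p\<close> to
        \<open>t\<close> costs at most a factor \<open>n powr - \<theta>\<close>.\<close>
      moreover have "\<theta> * ln p \<le> 0" using lnp \<theta> by (simp add: mult_le_0_iff)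
      moreover have "(1 - A - \<eta>) * (ln (real n) * \<theta>) \<le> 1 * (ln (real n) * \<theta>)"
        using A \<eta> lnn \<theta> by (intro mult_right_mono) auto
      ultimately have "(A + \<eta> - \<theta>) * ln (real n) - ln p \<le> (1 + \<theta>) * (x - 1) * ln p + ln (real n)"
        by (simp add: algebra_simps)
      then have "exp ((A + \<eta> - \<theta>) * ln (real n) - ln p)
        \<le> exp ((1 + \<theta>) * (x - 1) * ln p + ln (real n))"
        by simp
      then have "real n powr (A + \<eta> - \<theta>) / p \<le> p powr ((1 + \<theta>) * (x - 1)) * real n"
        using p n by (simp add: exp_diff exp_add powr_def)
      also have "p powr ((1 + \<theta>) * (x - 1)) \<le> t powr real (L - 2)"
      proof -
        have "real (L - 2) \<le> x - 1" using L by linarith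
        then show ?thesis using t powr_mono'[of "real (L - 2)" "x - 1" t]
          by (simp add: t_def powr_powr)
      qed
      finally show ?thesis using t by (simp add: powr_realpow mult_right_mono)
    qed
    define c where "c = t / (1 - t)"
    have c: "0 \<le> c" "c \<le> real n powr (A + \<theta>) / p"
    proof -
      show "0 \<le> c" using t by (simp add: c_def)
      have "c \<le> p / (1 - p)" unfolding c_def using t p by (intro frac_le) auto
      \<comment> \<open>Weakening \<open>p\<close> to \<open>1 / p\<close> puts \<open>c\<close> on
        the same scale as \<open>B\<close>.\<close>
      also have "\<dots> \<le> (1 / p) * (1 / (1 - p))"
        using p q0 by (simp add: divide_simps mult_le_one)
      also have "\<dots> \<le> (1 / p) * real n powr (A + \<theta>)"
        using q0 p by (intro mult_left_mono) auto
      finally show "c \<le> real n powr (A + \<theta>) / p" by simp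
    qed
    define E where "E = exp (- (c0 * p * (1 - p)) * (B\<^sup>2 / 4))"
    have "measure_pmf.prob ?M {f. \<not> has_clique f {1..n} L} \<le> (real (card {1..n}) + 1) ^ L * E"
    proof (rule prob_no_clique_le[OF _ t(1,2) c_def])
      show "finite {1..n}" "1 < B" "0 \<le> E" "{1..n} \<subseteq> {1..n}" "{1..n} \<noteq> {}" "1 \<le> L"
        using B L n by (auto simp: E_def)
      have "c \<le> (real n powr (A + \<eta> - \<theta>) / 2) / p"
        using c(2) divide_right_mono[OF n1, of p] p by linarith
      then have "c \<le> real n powr (A + \<eta> - \<theta>) / p - B"
        unfolding B_def by (simp add: field_simps)
      moreover have "0 \<le> t ^ (L - 2) * c" using c t by simp
      ultimately show "B \<le> t ^ (L - 2) * (real (card {1..n}) + c) - c"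
        using tL by (simp add: distrib_left)
    next
      fix S assume S: "S \<subseteq> {1..n}" "B \<le> real (card S)"
      have fS: "finite S" using S by (auto dest: finite_subset)
      obtain l where l: "l > 0" "l * t - (1 - exp (- l)) * p \<le> - (c0 * p * (1 - p)) \<or>
          l * t - l + (exp l - 1) * (1 - p) \<le> - (c0 * p * (1 - p))"
        using chernoff unfolding t_def by blast
      have "measure_pmf.prob ?M {f. (\<Sum>e\<in>nsets S 2. of_bool (f e)) \<le> t * real (card (nsets S 2))}
          \<le> exp (- (c0 * p * (1 - p)) * real (card (nsets S 2)))"
      proof (rule prob_few_le_exp[OF _ _ _ _ l])
        show "finite (nsets {1..n} 2)" by (simp add: finite_imp_finite_nsets)
        show "nsets S 2 \<subseteq> nsets {1..n} 2" using S by (rule_tac nsets_mono)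
        show "0 \<le> P (Min e) (Max e) \<and> P (Min e) (Max e) \<le> 1" if "e \<in> nsets {1..n} 2" for e
          using edge_probs_edge[OF P that] .
        show "p * real (card (nsets S 2)) \<le> (\<Sum>e\<in>nsets S 2. P (Min e) (Max e))"
        proof (rule edge_sum_ge[OF P S(1)])
          fix i assume i: "i \<in> S"
          have m: "real (card (S - {i})) = real (card S) - 1"
            using card_Suc_Diff1[OF fS i] by linarith
          show "p * real (card (S - {i})) \<le> (\<Sum>j\<in>S - {i}. P i j)"
          proof (rule avg)
            have "real (card (S - {i})) > 0" using m B S by linarith
            then show "S - {i} \<noteq> {}" by (metis card.empty of_nat_0 less_irrefl)
            \<comment> \<open>Removing \<open>i\<close> costs one vertex, which is the
              \<open>- 1\<close> in \<open>n2\<close>.\<close>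
            show "real n powr b \<le> real (card (S - {i}))" unfolding m using B S by linarith
          qed (use i S in auto)
        qed
      qed
      also have "\<dots> \<le> E"
      proof -
        \<comment> \<open>\<open>B \<ge> 2\<close> gives
          \<open>card S - 1 \<ge> B - 1 \<ge> B / 2\<close>.\<close>
        have "B * (B / 2) \<le> real (card S) * (real (card S) - 1)"
          using B S by (intro mult_mono) auto
        then have "B\<^sup>2 / 4 \<le> real (card (nsets S 2))"
          using card_nsets_2[OF fS] by (simp add: power2_eq_square)
        then have "c0 * p * (1 - p) * (B\<^sup>2 / 4) \<le> c0 * p * (1 - p) * real (card (nsets S 2))"
          using c0 p by (intro mult_left_mono) auto
        then show ?thesis by (simp add: E_def)
      qed
      finally show "measure_pmf.prob ?M {f. (\<Sum>e\<in>nsets S 2. of_bool (f e))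
        \<le> t * real (card (nsets S 2))} \<le> E" .
    qed
    also have "\<dots> = exp (real L * ln (real n + 1) - c0 * p * (1 - p) * (B\<^sup>2 / 4))"
    proof -
      have "(real (card {1..n}) + 1) ^ L = exp (real L * ln (real n + 1))"
        by (simp add: exp_of_nat_mult)
      then show ?thesis by (simp only: E_def exp_add[symmetric] mult_minus_left diff_conv_add_uminus)
    qed
    also have "\<dots> \<le> exp (- (real n powr \<kappa>))"
    proof -
      \<comment> \<open>As \<open>ln (1 / p) \<ge> 1 - p\<close>, the target, and with it the number
        of union bounds, is at most of order \<open>n powr (A + \<theta>) * ln n\<close>.\<close>
      have "1 / ln (1 / p) \<le> 1 / (1 - p)"
        using ln_le_minus_one[of p] p lnp by (intro frac_le) (auto simp: ln_div)
      then have "ln (real n) * (1 / ln (1 / p)) \<le> ln (real n) * real n powr (A + \<theta>)"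
        using q0 lnn by (intro mult_left_mono) auto
      moreover have "x \<le> 1 * (ln (real n) / ln (1 / p))"
        unfolding x_def using A \<eta> lnn lnp p
          by (intro mult_right_mono) (auto simp: ln_div divide_nonneg_neg)
      ultimately have "real L \<le> real n powr (A + \<theta>) * ln (real n) + 1"
        using L by (simp add: mult.commute)
      then have "real L * ln (real n + 1)
        \<le> (real n powr (A + \<theta>) * ln (real n) + 1) * ln (real n + 1)"
        by (intro mult_right_mono) auto
      moreover have "c0 / 16 * real n powr (2 * \<eta> + A - 3 * \<theta>) \<le> c0 * p * (1 - p) * (B\<^sup>2 / 4)"
      proof -
        \<comment> \<open>The exponent is
          \<open>2 * (A + \<eta> - \<theta>) - (A + \<theta>)\<close>; the 16 combines the 4 in
          \<open>B\<^sup>2 / 4\<close> with the square of the 2 in \<open>B\<close>.\<close>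
        have "c0 / 16 * real n powr (2 * \<eta> + A - 3 * \<theta>)
            = c0 / 16 * (real n powr - (A + \<theta>) * (real n powr (A + \<eta> - \<theta>))\<^sup>2)"
          by (simp add: power2_eq_square powr_add[symmetric] algebra_simps)
        also have "\<dots> \<le> c0 / 16 * ((1 / p) * (1 - p) * (real n powr (A + \<eta> - \<theta>))\<^sup>2)"
        proof (intro mult_left_mono mult_right_mono)
          have "1 * (1 - p) \<le> (1 / p) * (1 - p)" using p by (intro mult_right_mono) auto
          then show "real n powr - (A + \<theta>) \<le> (1 / p) * (1 - p)"
            unfolding mult_1_left using q by (rule order_trans[rotated])
        qed (use c0 in auto)
        also have "\<dots> = c0 * p * (1 - p) * (B\<^sup>2 / 4)"
          using p by (simp add: B_def power2_eq_square field_simps)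
        finally show ?thesis .
      qed
      ultimately show ?thesis using n4 by simp
    qed
    finally show ?thesis using prob_clique_ge_lower[OF L(2), of n P] unfolding x_def by linarith
  qed
qed

section \<open>Large numbers of vertices and the three cases\<close>

text \<open>The threshold precedes \<open>a\<close> and \<open>P\<close>: sets of size at least
  \<open>n powr b\<close> meet the size condition for every \<open>a \<le> b\<close>, so only
  \<open>b\<close> enters the asymptotics.\<close>

lemma prob_clique_ge_eventually:
  fixes p :: "nat \<Rightarrow> real" and A \<eta> b \<kappa> :: real
  assumes p: "\<forall>n\<ge>1. 0 < p n \<and> p n < 1"
    and A: "A \<ge> 0" and \<eta>: "\<eta> > 0" "A + \<eta> < 1" and b: "b < A + \<eta>" and \<kappa>: "\<kappa> < 2 * \<eta> + A"
    and q: "\<And>e. e > 0 \<Longrightarrow> \<forall>\<^sub>F n in sequentially. real n powr - (A + e) \<le> 1 - p n"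
  shows "\<exists>M::nat. M \<ge> 1 \<and> (\<forall>a P. a \<le> b \<and> in_class N a p P \<longrightarrow> (\<forall>n\<ge>M.
      prob_clique_ge n (P n) ((1 - A - \<eta>) * (ln (real n) / ln (1 / p n)))
        \<ge> 1 - 3 * exp (- (real n powr \<kappa>))))"
proof -
  \<comment> \<open>A quarter of the smallest margin suffices, since at most
    \<open>3 * \<theta>\<close> is lost in the exponents.\<close>
  define \<theta> where "\<theta> = min \<eta> (min (A + \<eta> - b) (2 * \<eta> + A - \<kappa>)) / 4"
  have "4 * \<theta> \<le> \<eta>" "4 * \<theta> \<le> A + \<eta> - b" "4 * \<theta> \<le> 2 * \<eta> + A - \<kappa>" "\<theta> > 0"
    using \<eta> b \<kappa> unfolding \<theta>_def by auto
  then have \<theta>: "\<theta> > 0" "2 * \<theta> < \<eta>" "b < A + \<eta> - \<theta>" "\<kappa> < 2 * \<eta> + A - 3 * \<theta>"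
    by linarith+
  obtain c0 where c0: "c0 > 0" and
    ch: "\<And>p. 0 < p \<Longrightarrow> p < 1 \<Longrightarrow> \<exists>l>0.
       l * p powr (1 + \<theta>) - (1 - exp (- l)) * p \<le> - (c0 * p * (1 - p)) \<or>
       l * p powr (1 + \<theta>) - l + (exp l - 1) * (1 - p) \<le> - (c0 * p * (1 - p))"
    using chernoff_exponent[OF \<theta>(1)] by blast
  have c16: "c0 / 16 > 0" using c0 by simp
  have "\<forall>\<^sub>F n in sequentially. \<forall>a P. a \<le> b \<and> in_class N a p P \<longrightarrow>
      prob_clique_ge n (P n) ((1 - A - \<eta>) * (ln (real n) / ln (1 / p n)))
        \<ge> 1 - 3 * exp (- (real n powr \<kappa>))"
    using powr_bounds_eventually[OF A \<theta> c16] q[OF \<theta>(1)] eventually_ge_at_top[of "max 2 N"]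
  proof eventually_elim
    case (elim n)
    show ?case
    proof (intro allI impI)
      fix a P assume aP: "a \<le> b \<and> in_class N a p P"
      have n: "n \<ge> 2" "n \<ge> N" using elim(3) by auto
      have "1 - exp (- (real n powr \<kappa>))
        \<le> prob_clique_ge n (P n) ((1 - A - \<eta>) * (ln (real n) / ln (1 / p n)))"
      proof (rule prob_clique_ge_bound[OF A \<eta> \<theta>(1) c0 n(1) _ _ elim(2) ch])
        show "0 < p n" "p n < 1" "0 < p n" "p n < 1" using p n by auto
        show "edge_probs n (P n)" using aP n by (auto simp: in_class_def)
        fix i S assume S: "i \<in> {1..n}" "S \<subseteq> {1..n}" "i \<notin> S" "S \<noteq> {}" "real n powr b \<le> real (card S)"
        have "real n powr a \<le> real n powr b" using aP n by (intro powr_mono) auto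
        also note S(5)
        finally show "p n * real (card S) \<le> (\<Sum>j\<in>S. P n i j)"
          using S aP n by (intro in_class_average[of N a]) auto
      qed (use elim(1) c0 in auto)
      then show "prob_clique_ge n (P n) ((1 - A - \<eta>) * (ln (real n) / ln (1 / p n)))
          \<ge> 1 - 3 * exp (- (real n powr \<kappa>))" using exp_ge_zero[of "- (real n powr \<kappa>)"] by linarith
    qed
  qed
  then obtain M where "\<forall>n\<ge>M. \<forall>a P. a \<le> b \<and> in_class N a p P \<longrightarrow>
      prob_clique_ge n (P n) ((1 - A - \<eta>) * (ln (real n) / ln (1 / p n)))
        \<ge> 1 - 3 * exp (- (real n powr \<kappa>))" unfolding eventually_sequentially by blast
  then show ?thesis by (intro exI[of _ "max 1 M"]) auto
qed

lemma one_minus_p_ge: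
  assumes p: "\<forall>n\<ge>1. 0 < p n \<and> p n < 1" and A: "alpha2 p = ereal A" and e: "e > 0"
  shows "\<forall>\<^sub>F n in sequentially. real n powr - (A + e) \<le> 1 - p n"
proof -
  have "\<forall>\<^sub>F n in sequentially. log_ratio2 p n < ereal (A + e)"
    using A e unfolding alpha2_def by (intro Limsup_lessD) auto
  then show ?thesis using eventually_ge_at_top[of 2]
  proof eventually_elim
    case (elim n)
    have pn: "0 < p n" "p n < 1" using p elim by auto
    have "- ln (1 - p n) < (A + e) * ln (real n)"
      using elim pn ln_gt_zero[of "real n"] by (simp add: log_ratio2_def ln_div field_simps)
    then have "exp (- (A + e) * ln (real n)) \<le> exp (ln (1 - p n))"
      by (subst exp_le_cancel_iff) (simp add: algebra_simps)
    then show ?case using elim pn by (simp add: powr_def)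
  qed
qed

text \<open>A positive limit forces \<open>r n\<close> below a negative power of \<open>n\<close>,
  hence to 0, and \<open>ln (1 / (1 - r n))\<close> with it. A positive upper limit would give this
  decay only along a subsequence. Both \<open>p\<close> and \<open>1 - p\<close> take the place of
  \<open>r\<close>.\<close>

lemma ratio_tendsto_imp_ratio_zero:
  fixes r :: "nat \<Rightarrow> real" and \<alpha> :: ereal
  assumes r: "\<forall>n\<ge>1. 0 < r n \<and> r n < 1" and \<alpha>: "0 < \<alpha>"
    and lim: "(\<lambda>n. ereal (ln (1 / r n) / ln (real n))) \<longlonglongrightarrow> \<alpha>"
  shows "limsup (\<lambda>n. ereal (ln (1 / (1 - r n)) / ln (real n))) = 0"
proof -
  obtain y where y: "0 < ereal y" "ereal y < \<alpha>" using ereal_dense2[OF \<alpha>] by blast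
  have "\<forall>\<^sub>F n in sequentially. ereal y < ereal (ln (1 / r n) / ln (real n))"
    using lim y(2) by (rule order_tendstoD)
  then have le: "\<forall>\<^sub>F n in sequentially. r n \<le> real n powr - y"
    using eventually_ge_at_top[of 2]
  proof eventually_elim
    case (elim n)
    have rn: "0 < r n" "r n < 1" using r elim by auto
    have "y * ln (real n) < - ln (r n)"
      using elim rn ln_gt_zero[of "real n"] by (simp add: ln_div field_simps)
    then have "exp (ln (r n)) \<le> exp (- y * ln (real n))"
      by (subst exp_le_cancel_iff) (simp add: algebra_simps)
    then show ?case using elim rn by (simp add: powr_def)
  qed
  have lim0: "((\<lambda>n. real n powr - y) \<longlongrightarrow> 0) sequentially" using y by real_asymp
  have r0: "r \<longlonglongrightarrow> 0"
    by (rule tendsto_sandwich[OF _ le tendsto_const lim0])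
      (use r in \<open>auto simp: eventually_sequentially intro!: exI[of _ 1] less_imp_le\<close>)
  have "((\<lambda>n. ln (1 / (1 - r n))) \<longlongrightarrow> ln (1 / (1 - 0))) sequentially"
    by (intro tendsto_intros r0) auto
  moreover have "filterlim (\<lambda>n. ln (real n)) at_infinity sequentially" by real_asymp
  ultimately have "(\<lambda>n. ln (1 / (1 - r n)) / ln (real n)) \<longlonglongrightarrow> 0" by (rule tendsto_divide_0)
  then have "(\<lambda>n. ereal (ln (1 / (1 - r n)) / ln (real n))) \<longlonglongrightarrow> ereal 0" by (rule tendsto_ereal)
  then show ?thesis by (intro lim_imp_Limsup) (auto simp: zero_ereal_def)
qed

text \<open>The quantifiers follow the stated dependencies: \<open>N1\<close> may depend on
  \<open>a\<close>, whereas \<open>N2\<close> and \<open>N3\<close> precede it. Vanishing of the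
  other upper limit is derived from convergence of the ratio and assumed in the bounds, as upper
  limits alone do not force it.\<close>

theorem theorem1:
  fixes p :: "nat \<Rightarrow> real" and N :: nat
  assumes p: "\<forall>n\<ge>1. 0 < p n \<and> p n < 1"
    and N: "N \<ge> 1"
  shows
    "(0 < alpha1 p \<and> alpha1 p < 2 \<longrightarrow>
        (log_ratio1 p \<longlonglongrightarrow> alpha1 p \<longrightarrow> alpha2 p = 0) \<and>
        (alpha2 p = 0 \<longrightarrow>
          (\<forall>a \<eta> \<gamma> :: real.
             0 \<le> a \<and> a < 1 \<and> 0 < \<eta> \<and> 0 < \<gamma> \<and>
             max (real_of_ereal (alpha1 p) / 2) a + \<gamma> < \<eta> \<and> \<eta> < 1 \<longrightarrow>
             (\<exists>N1::nat. N1 \<ge> 1 \<and>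
               (\<forall>P. in_class N a p P \<longrightarrow>
                 (\<forall>n\<ge>N1.
                   prob_clique_ge n (P n) ((1 - \<eta>) * (ln (real n) / ln (1 / p n)))
                     \<ge> 1 - 3 * exp (- (real n powr (2 * \<eta> - 2 * \<gamma> - real_of_ereal (alpha1 p)))))))))) \<and>
     (alpha1 p = 0 \<and> alpha2 p = 0 \<longrightarrow>
        (\<forall>\<eta> \<gamma> :: real.
           0 < \<eta> \<and> 0 < \<gamma> \<longrightarrow>
           (\<exists>N2::nat. N2 \<ge> 1 \<and>
             (\<forall>a P. 0 \<le> a \<and> a < 1 \<and> a < \<gamma> \<and> \<gamma> < \<eta> \<and> \<eta> < 1 \<and> in_class N a p P \<longrightarrow>
               (\<forall>n\<ge>N2.
                 prob_clique_ge n (P n) ((1 - \<eta>) * (ln (real n) / ln (1 / p n)))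
                   \<ge> 1 - 3 * exp (- (real n powr (2 * \<eta> - 2 * \<gamma>)))))))) \<and>
     (0 < alpha2 p \<and> alpha2 p < 1 \<longrightarrow>
        (log_ratio2 p \<longlonglongrightarrow> alpha2 p \<longrightarrow> alpha1 p = 0) \<and>
        (alpha1 p = 0 \<longrightarrow>
          (\<forall>\<eta> \<gamma> :: real.
             0 < \<eta> \<and> 0 < \<gamma> \<longrightarrow>
             (\<exists>N3::nat. N3 \<ge> 1 \<and>
               (\<forall>a P. 0 \<le> a \<and> a < 1 \<and>
                   max (\<gamma> - real_of_ereal (alpha2 p) / 2) a < \<eta> \<and>
                   \<eta> < 1 - real_of_ereal (alpha2 p) \<and> in_class N a p P \<longrightarrow>
                 (\<forall>n\<ge>N3.
                   prob_clique_ge n (P n)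
                       ((1 - real_of_ereal (alpha2 p) - \<eta>) * (ln (real n) / ln (1 / p n)))
                     \<ge> 1 - 3 * exp (- (real n powr (2 * \<eta> - 2 * \<gamma> + real_of_ereal (alpha2 p))))))))))"
proof (intro conjI impI allI; (elim conjE)?)
  assume "0 < alpha1 p" "log_ratio1 p \<longlonglongrightarrow> alpha1 p"
  then show "alpha2 p = 0"
    using ratio_tendsto_imp_ratio_zero[OF p] unfolding alpha2_def log_ratio1_def log_ratio2_def by blast
next
  fix a \<eta> \<gamma> :: real
  assume "0 < alpha1 p" "alpha1 p < 2" "alpha2 p = 0" "0 \<le> a" "0 < \<gamma>" "0 < \<eta>" "\<eta> < 1"
    and "max (real_of_ereal (alpha1 p) / 2) a + \<gamma> < \<eta>"
  \<comment> \<open>With \<open>\<gamma> > 0\<close> this keeps the exponent below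
    \<open>2 * \<eta>\<close>, as the instance \<open>A = 0\<close>, \<open>b = a\<close>
    requires.\<close>
  moreover from this have "real_of_ereal (alpha1 p) \<ge> 0" by (simp add: real_of_ereal_pos)
  ultimately have "\<exists>M::nat. M \<ge> 1 \<and> (\<forall>a' P. a' \<le> a \<and> in_class N a' p P \<longrightarrow> (\<forall>n\<ge>M.
      prob_clique_ge n (P n) ((1 - 0 - \<eta>) * (ln (real n) / ln (1 / p n)))
        \<ge> 1 - 3 * exp (- (real n powr (2 * \<eta> - 2 * \<gamma> - real_of_ereal (alpha1 p))))))"
    by (intro prob_clique_ge_eventually p one_minus_p_ge) (auto simp: zero_ereal_def)
  then show "\<exists>N1::nat. N1 \<ge> 1 \<and> (\<forall>P. in_class N a p P \<longrightarrow> (\<forall>n\<ge>N1.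
      prob_clique_ge n (P n) ((1 - \<eta>) * (ln (real n) / ln (1 / p n)))
        \<ge> 1 - 3 * exp (- (real n powr (2 * \<eta> - 2 * \<gamma> - real_of_ereal (alpha1 p))))))"
    by (elim ex_forward) auto
next
  fix \<eta> \<gamma> :: real
  assume *: "alpha2 p = 0" "0 < \<gamma>" "0 < \<eta>"
  show "\<exists>N2::nat. N2 \<ge> 1 \<and> (\<forall>a P. 0 \<le> a \<and> a < 1 \<and> a < \<gamma> \<and> \<gamma> < \<eta> \<and> \<eta> < 1 \<and> in_class N a p P \<longrightarrow>
      (\<forall>n\<ge>N2. prob_clique_ge n (P n) ((1 - \<eta>) * (ln (real n) / ln (1 / p n)))
        \<ge> 1 - 3 * exp (- (real n powr (2 * \<eta> - 2 * \<gamma>)))))"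
  \<comment> \<open>If \<open>\<gamma> < \<eta> < 1\<close> fails, no \<open>a\<close> is admissible
    and any threshold will do; otherwise \<open>b = \<gamma>\<close> bounds every admissible
    \<open>a\<close>.\<close>
  proof (cases "\<gamma> < \<eta> \<and> \<eta> < 1")
    case True
    with * have "\<exists>M::nat. M \<ge> 1 \<and> (\<forall>a P. a \<le> \<gamma> \<and> in_class N a p P \<longrightarrow> (\<forall>n\<ge>M.
        prob_clique_ge n (P n) ((1 - 0 - \<eta>) * (ln (real n) / ln (1 / p n)))
          \<ge> 1 - 3 * exp (- (real n powr (2 * \<eta> - 2 * \<gamma>)))))"
      by (intro prob_clique_ge_eventually p one_minus_p_ge) (auto simp: zero_ereal_def)
    then show ?thesis by (elim ex_forward) (auto dest!: less_imp_le[of _ \<gamma>])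
  qed auto
next
  assume "0 < alpha2 p" "log_ratio2 p \<longlonglongrightarrow> alpha2 p"
  then show "alpha1 p = 0"
    using ratio_tendsto_imp_ratio_zero[of "\<lambda>n. 1 - p n" "alpha2 p"] p
    unfolding alpha1_def log_ratio1_def log_ratio2_def by simp
next
  fix \<eta> \<gamma> :: real
  assume *: "0 < alpha2 p" "alpha2 p < 1" "0 < \<gamma>" "0 < \<eta>"
  then obtain A where A: "alpha2 p = ereal A" by (cases "alpha2 p") auto
  show "\<exists>N3::nat. N3 \<ge> 1 \<and> (\<forall>a P. 0 \<le> a \<and> a < 1 \<and>
      max (\<gamma> - real_of_ereal (alpha2 p) / 2) a < \<eta> \<and>
      \<eta> < 1 - real_of_ereal (alpha2 p) \<and> in_class N a p P \<longrightarrow>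
      (\<forall>n\<ge>N3. prob_clique_ge n (P n)
          ((1 - real_of_ereal (alpha2 p) - \<eta>) * (ln (real n) / ln (1 / p n)))
        \<ge> 1 - 3 * exp (- (real n powr (2 * \<eta> - 2 * \<gamma> + real_of_ereal (alpha2 p))))))"
  \<comment> \<open>Here \<open>b = \<eta>\<close> serves all admissible \<open>a\<close>, as
    \<open>b < A + \<eta>\<close> follows from \<open>A > 0\<close>.\<close>
  proof (cases "\<eta> < 1 - A")
    case True
    have "\<exists>M::nat. M \<ge> 1 \<and> (\<forall>a P. a \<le> \<eta> \<and> in_class N a p P \<longrightarrow> (\<forall>n\<ge>M.
        prob_clique_ge n (P n) ((1 - A - \<eta>) * (ln (real n) / ln (1 / p n)))
          \<ge> 1 - 3 * exp (- (real n powr (2 * \<eta> - 2 * \<gamma> + A)))))"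
      using * A True by (intro prob_clique_ge_eventually p one_minus_p_ge) auto
    then show ?thesis unfolding A by (elim ex_forward) (auto dest!: less_imp_le[of _ \<eta>])
  qed (use A in auto)
qed

end
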